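(* Let $b,\rho\in\mathbb{C}$ with $\operatorname{Re}(\rho)>0$ and let $z\in\mathbb{C}\setminus(-\infty,0]$. (i) For $\nu,c\in\mathbb{C}$ with $\operatorname{Re}(\nu)>-\tfrac32$, $\operatorname{Re}(c)>\tfrac12$, $$\frac{\partial}{\partial z}\Big[z^{\nu+\frac32}\frac{\partial}{\partial z}\big[z^{-\nu}g_\nu^{(b,c-1)}(z;\rho)\big]\Big]=-b\,z^{\frac12}\big(c-\tfrac32\big)\,g_{\nu+1}^{(b,c)}(z;\rho).$$ (ii) For $\nu,\lambda\in\mathbb{C}$ with $\operatorname{Re}(\nu)>-1$, $\operatorname{Re}(\lambda)>0$, $$\frac{\partial}{\partial z}\Big[(\sqrt z)^{\nu+2}\frac{\partial}{\partial z}\big(C_\nu^{(b,\lambda-1)}(z;\rho)\big)\Big]=\frac{-b(\lambda-1)}2(\sqrt z)^\nu\,C_{\nu+1}^{(b,\lambda)}(z;\rho).$$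
   Context: For $\rho\in\mathbb{C}$ with $\operatorname{Re}(\rho)>0$ and $x\in\mathbb{C}$ put $\Gamma_\rho(x)=\int_0^\infty t^{x-1}e^{-t-\rho/t}\,dt$. The generalized Pochhammer symbol is $(\lambda;\rho)_\nu:=\Gamma_\rho(\lambda+\nu)/\Gamma(\lambda)$ for $\lambda,\nu\in\mathbb{C}$, where $1/\Gamma$ is read as an entire function (zero at $0,-1,-2,\dots$). The unified four parameter Bessel function is $G_\nu^{(b,c)}(z;\rho):=\sum_{k=0}^\infty \frac{(-b)^k (c;\rho)_{2k+\nu}}{\Gamma(\nu+k+1)\,\Gamma(\nu+2k+1)}\,\frac{(z/2)^{2k+\nu}}{k!}$. The generalized four parameter spherical Bessel and Bessel-Clifford functions are $$g_\nu^{(b,c)}(z;\rho):=\sqrt{\tfrac{\pi}{2z}}\,G_{\nu+\frac12}^{(b,c-\frac12)}(z;\rho)=\frac{\sqrt\pi}{2}\sum_{k=0}^\infty\frac{(-b)^k(c-\frac12;\rho)_{2k+\nu+\frac12}}{k!\,\Gamma(\nu+k+\frac32)\,\Gamma(\nu+2k+\frac32)}\Big(\frac z2\Big)^{2k+\nu},$$ $$C_\nu^{(b,\lambda)}(z;\rho):=z^{-\nu/2}G_\nu^{(b,\lambda)}(2\sqrt z;\rho)=\sum_{k=0}^\infty\frac{(-b)^k(\lambda;\rho)_{2k+\nu}}{k!\,\Gamma(\nu+k+1)\,\Gamma(\nu+2k+1)}\,z^k.$$ Functions with shifted parameters are given by the same series. Powers and square roots are principal. *)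

theory Defs
  imports "HOL-Analysis.Analysis"
begin

definition ext_Gamma :: "complex \<Rightarrow> complex \<Rightarrow> complex" where
  "ext_Gamma \<rho> x =
     (LINT t:{0<..}|lborel. complex_of_real t powr (x - 1) * exp (- of_real t - \<rho> / of_real t))"

(* rGamma is the entire function 1/Gamma, so the symbol vanishes for lam = 0, -1, -2, ... *)
definition ext_pochhammer :: "complex \<Rightarrow> complex \<Rightarrow> complex \<Rightarrow> complex" where
  "ext_pochhammer lam \<rho> \<nu> = ext_Gamma \<rho> (lam + \<nu>) * rGamma lam"

(* Argument order here and below: order \<nu>, upper parameters (b,c), then z and \<rho>.
   At z = 0 the summand of exponent 0 is 0 rather than 1, because 0 powr 0 = 0. *)
definition unified_bessel :: "complex \<Rightarrow> complex \<Rightarrow> complex \<Rightarrow> complex \<Rightarrow> complex \<Rightarrow> complex" where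
  "unified_bessel \<nu> b c z \<rho> =
     (\<Sum>k. (- b) ^ k * ext_pochhammer c \<rho> (2 * of_nat k + \<nu>)
            / (Gamma (\<nu> + of_nat k + 1) * Gamma (\<nu> + 2 * of_nat k + 1))
            * ((z / 2) powr (2 * of_nat k + \<nu>) / fact k))"

definition gen_spherical_bessel ::
    "complex \<Rightarrow> complex \<Rightarrow> complex \<Rightarrow> complex \<Rightarrow> complex \<Rightarrow> complex" where
  "gen_spherical_bessel \<nu> b c z \<rho> =
     csqrt (of_real pi / (2 * z)) * unified_bessel (\<nu> + 1 / 2) b (c - 1 / 2) z \<rho>"

definition gen_bessel_clifford ::
    "complex \<Rightarrow> complex \<Rightarrow> complex \<Rightarrow> complex \<Rightarrow> complex \<Rightarrow> complex" where
  "gen_bessel_clifford \<nu> b lam z \<rho> =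
     z powr (- \<nu> / 2) * unified_bessel \<nu> b lam (2 * csqrt z) \<rho>"

end

theory Submission
  imports Defs "HOL-Real_Asymp.Real_Asymp"
begin

text \<open>
  Both formulas are one second order identity seen through two changes of variable. Up to the
  powers of \<open>z\<close> that carry the branch cut, the Bessel-Clifford function is an everywhere
  convergent power series
  \<open>F\<^sub>\<nu>(w) = \<Sum>k. a\<^sub>k w\<^sup>k\<close> (\<open>clifford_entire\<close>). Comparing coefficients, and using only the functional
  equation of \<open>1/\<Gamma>\<close>, gives (\<open>clifford_entire_ode\<close>)

  \<open>w F'' + (\<nu>/2 + 1) F' = - b (\<lambda> - 1)/2 \<sqdot> F\<^sub>+\<close>,

  where \<open>F\<close> has order \<open>\<nu>\<close> and upper parameter \<open>\<lambda> - 1\<close>, and \<open>F\<^sub>+\<close> has order \<open>\<nu> + 1\<close> and upper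
  parameter \<open>\<lambda>\<close>.
  The coefficients of \<open>w\<^sup>k\<close> on both sides contain \<open>\<Gamma>\<^sub>\<rho>\<close> at the same point \<open>\<lambda> + 2k + \<nu> + 1\<close>, so it
  is carried along as an opaque factor.

  Off the cut, the Bessel-Clifford function is \<open>F\<^sub>\<nu>(z)\<close>, and \<open>z\<^sup>-\<^sup>\<nu>\<close> times the spherical function of
  order \<open>\<nu>\<close> is a constant times \<open>F\<close> of order \<open>\<nu> + 1/2\<close> at \<open>z\<^sup>2/4\<close>. The chosen outer powers of \<open>z\<close> are the
  integrating factors that turn the left side of the identity into a derivative:
  \<open>(z\<^bsup>\<nu>/2+1\<^esup> F')' = z\<^bsup>\<nu>/2\<^esup> (z F'' + (\<nu>/2 + 1) F')\<close>, and similarly after the substitution.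

  The analytic input is the convergence of the series. It rests on
  \<open>\<bar>\<Gamma>\<^sub>\<rho>(x)\<bar> \<le> \<Gamma>(Re x)\<close>, so that the numerator grows at most like \<open>\<Gamma>(2k)\<close> and the denominator like
  \<open>\<Gamma>(2k) k!\<^sup>2\<close>, up to powers of \<open>k\<close> and exponential factors.
\<close>

section \<open>Convergence of the Bessel-Clifford power series\<close>

text \<open>
  For \<open>t > 0\<close> the factor \<open>exp (- \<rho>/t)\<close> has modulus at most 1, so Euler's integral dominates. If
  the integrand fails to be integrable, its Bochner integral is 0, which satisfies the bound too.
\<close>
lemma norm_ext_Gamma_le:
  assumes "Re \<rho> \<ge> 0" and "Re x > 0"
  shows "norm (ext_Gamma \<rho> x) \<le> Gamma (Re x)"
proof -
  define f where "f = (\<lambda>t. indicator {0<..} t *\<^sub>R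
      (complex_of_real t powr (x - 1) * exp (- of_real t - \<rho> / of_real t)))"
  have ext: "ext_Gamma \<rho> x = integral\<^sup>L lborel f"
    by (simp add: ext_Gamma_def f_def set_lebesgue_integral_def)
  have le: "norm (f t) \<le> indicator {0..} t * t powr (Re x - 1) / exp t" for t :: real
  proof (cases "t > 0")
    case True
    have "Re (\<rho> / of_real t) \<ge> 0"
      using True assms(1) by (simp add: Re_divide_of_real)
    hence "exp (- t - Re (\<rho> / of_real t)) \<le> exp (- t)"
      by simp
    hence "t powr (Re x - 1) * exp (- t - Re (\<rho> / of_real t)) \<le> t powr (Re x - 1) * exp (- t)"
      by (intro mult_left_mono) auto
    thus ?thesis
      using True by (simp add: f_def norm_mult norm_powr_real_powr exp_minus field_simps)
  qed (auto simp: f_def)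
  show ?thesis
  proof (cases "integrable lborel f")
    case True
    have "ennreal (norm (integral\<^sup>L lborel f)) \<le> (\<integral>\<^sup>+t. norm (f t) \<partial>lborel)"
      by (rule integral_norm_bound_ennreal[OF True])
    also have "\<dots> \<le> (\<integral>\<^sup>+t. ennreal (indicator {0..} t * t powr (Re x - 1) / exp t) \<partial>lborel)"
      by (intro nn_integral_mono ennreal_leI le)
    also have "\<dots> = ennreal (Gamma (Re x))"
      by (rule Gamma_conv_nn_integral_real[OF assms(2), symmetric])
    finally show ?thesis
      using assms(2) by (simp add: ext ennreal_le_iff)
  next
    case False
    thus ?thesis
      using assms(2) by (simp add: ext not_integrable_integral_eq)
  qed
qed

text \<open>
  With \<open>rGamma\<close> instead of a quotient by \<open>Gamma\<close>, the functional equation holds at the poles as well,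
  so that the recurrences below are free of side conditions on \<open>\<nu>\<close>. The values agree with those of the
  quotient, because \<open>Gamma\<close> is 0 at its poles and division by 0 gives 0.
\<close>
definition clifford_coeff ::
    "complex \<Rightarrow> complex \<Rightarrow> complex \<Rightarrow> complex \<Rightarrow> nat \<Rightarrow> complex" where
  "clifford_coeff \<nu> b lam \<rho> k =
     (- b) ^ k * ext_pochhammer lam \<rho> (2 * of_nat k + \<nu>)
       * rGamma (\<nu> + of_nat k + 1) * rGamma (\<nu> + 2 * of_nat k + 1) / fact k"

text \<open>
  The ratio test: passing from \<open>k\<close> to \<open>k + 1\<close> multiplies the term by at most a quotient of a
  quadratic polynomial in \<open>k\<close> by a quartic one. The growth of \<open>rGamma\<close> is read off from its functional equation
  alone, with \<open>\<bar>\<nu> + m\<bar> \<ge> m - \<bar>\<nu>\<bar>\<close>.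
\<close>
lemma summable_clifford_majorant:
  fixes \<nu> :: complex and a x :: real
  assumes "x \<ge> 0"
  shows "summable (\<lambda>k. Gamma (a + 2 * real k) * norm (rGamma (\<nu> + of_nat k + 1))
           * norm (rGamma (\<nu> + 2 * of_nat k + 1)) * x ^ k / fact k)"
    (is "summable ?B")
proof -
  define n where "n = norm \<nu>"
  have "((\<lambda>k. (a + 2 * real k) * (a + 2 * real k + 1) * x /
            ((real k + 1 - n) * (2 * real k + 1 - n) * (2 * real k + 2 - n) * (real k + 1)))
          \<longlonglongrightarrow> 0)"
    by real_asymp
  hence "\<forall>\<^sub>F k in sequentially. (a + 2 * real k) * (a + 2 * real k + 1) * x /
            ((real k + 1 - n) * (2 * real k + 1 - n) * (2 * real k + 2 - n) * (real k + 1)) < 1 / 2"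
    by (rule order_tendstoD) simp
  moreover have "\<forall>\<^sub>F k in sequentially. a + 2 * real k > 0"
    by real_asymp
  moreover have "\<forall>\<^sub>F k in sequentially. real k > n"
    by real_asymp
  ultimately have "\<forall>\<^sub>F k in sequentially. norm (?B (Suc k)) \<le> 1 / 2 * norm (?B k)"
  proof eventually_elim
    case (elim k)
    define D where "D = (real k + 1 - n) * (2 * real k + 1 - n) * (2 * real k + 2 - n) * (real k + 1)"
    define p where "p = norm (\<nu> + of_nat k + 1)"
    define q where "q = norm (\<nu> + 2 * of_nat k + 1)"
    define r where "r = norm (\<nu> + 2 * of_nat k + 2)"
    have shift: "m - n \<le> norm (\<nu> + of_real m)" for m :: real
      using norm_triangle_ineq4[of "\<nu> + of_real m" \<nu>] by (simp add: n_def)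
    have p: "real k + 1 - n \<le> p"
      using shift[of "real k + 1"] by (simp add: p_def add_ac)
    have q: "2 * real k + 1 - n \<le> q"
      using shift[of "2 * real k + 1"] by (simp add: q_def add_ac)
    have r: "2 * real k + 2 - n \<le> r"
      using shift[of "2 * real k + 2"] by (simp add: r_def add_ac)
    have "D > 0"
      unfolding D_def using elim(3) by (intro mult_pos_pos) auto
    have "D \<le> p * q * r * (real k + 1)"
      unfolding D_def using p q r elim(3) by (intro mult_mono mult_right_mono mult_nonneg_nonneg) auto
    have G: "Gamma (a + 2 * real (Suc k)) = (a + 2 * real k) * (a + 2 * real k + 1) * Gamma (a + 2 * real k)"
      using Gamma_plus1[of "a + 2 * real k"] Gamma_plus1[of "a + 2 * real k + 1"] elim(2)
      by (simp add: add_ac nonpos_Ints_def)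
    have P: "norm (rGamma (\<nu> + of_nat k + 1)) = p * norm (rGamma (\<nu> + of_nat (Suc k) + 1))"
      using arg_cong[OF rGamma_plus1[of "\<nu> + of_nat k + 1"], of norm]
      by (simp add: p_def norm_mult add_ac)
    have QR: "norm (rGamma (\<nu> + 2 * of_nat k + 1)) = q * r * norm (rGamma (\<nu> + 2 * of_nat (Suc k) + 1))"
    proof -
      have "norm (rGamma (\<nu> + 2 * of_nat k + 1)) = q * norm (rGamma (\<nu> + 2 * of_nat k + 2))"
        using arg_cong[OF rGamma_plus1[of "\<nu> + 2 * of_nat k + 1"], of norm]
        by (simp add: q_def norm_mult add_ac)
      also have "norm (rGamma (\<nu> + 2 * of_nat k + 2)) =
          r * norm (rGamma (\<nu> + 2 * of_nat (Suc k) + 1))"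
        using arg_cong[OF rGamma_plus1[of "\<nu> + 2 * of_nat k + 2"], of norm]
        by (simp add: r_def norm_mult add_ac)
      finally show ?thesis
        by simp
    qed
    have B0: "?B k \<ge> 0" "?B (Suc k) \<ge> 0"
      using elim(2) assms by auto
    have "?B (Suc k) * D \<le> ?B (Suc k) * (p * q * r * (real k + 1))"
      using \<open>D \<le> _\<close> B0(2) by (rule mult_left_mono)
    also have "\<dots> = ?B k * ((a + 2 * real k) * (a + 2 * real k + 1) * x)"
    proof -
      have cancel: "M * g * P' * Q' * (x * y) / (s * f) * (p * q * r * s) =
          g * (p * P') * (q * r * Q') * y / f * (M * x)"
        if "s \<noteq> 0" "f \<noteq> 0" for M g P' Q' y s f :: real
        using that by simp
      have fct: "fact (Suc k) = (real k + 1) * fact k"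
        by simp
      show ?thesis
        unfolding G P QR fct power_Suc by (rule cancel) auto
    qed
    also have "\<dots> \<le> ?B k * (1 / 2 * D)"
    proof (rule mult_left_mono[OF _ B0(1)])
      show "(a + 2 * real k) * (a + 2 * real k + 1) * x \<le> 1 / 2 * D"
        using elim(1)[folded D_def] \<open>D > 0\<close> by (simp only: pos_divide_less_eq less_imp_le)
    qed
    finally have "?B (Suc k) * D \<le> (1 / 2 * ?B k) * D"
      by (simp add: mult_ac)
    hence "?B (Suc k) \<le> 1 / 2 * ?B k"
      using \<open>D > 0\<close> by (rule mult_right_le_imp_le)
    thus ?case
      using B0 by (simp only: real_norm_def abs_of_nonneg)
  qed
  then obtain N where "\<And>k. k \<ge> N \<Longrightarrow> norm (?B (Suc k)) \<le> 1 / 2 * norm (?B k)"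
    by (auto simp: eventually_at_top_linorder)
  thus ?thesis
    by (intro summable_ratio_test[of "1 / 2" N ?B]) auto
qed

lemma summable_clifford_series:
  assumes "Re \<rho> \<ge> 0"
  shows "summable (\<lambda>k. clifford_coeff \<nu> b lam \<rho> k * w ^ k)"
proof (rule summable_comparison_test_ev)
  define a where "a = Re (lam + \<nu>)"
  let ?B = "\<lambda>k. Gamma (a + 2 * real k) * norm (rGamma (\<nu> + of_nat k + 1))
           * norm (rGamma (\<nu> + 2 * of_nat k + 1)) * norm (b * w) ^ k / fact k"
  show "summable (\<lambda>k. norm (rGamma lam) * ?B k)"
    by (intro summable_mult summable_clifford_majorant) simp
  have "\<forall>\<^sub>F k in sequentially. a + 2 * real k > 0"
    by real_asymp
  thus "\<forall>\<^sub>F k in sequentially.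
          norm (clifford_coeff \<nu> b lam \<rho> k * w ^ k) \<le> norm (rGamma lam) * ?B k"
  proof eventually_elim
    case (elim k)
    have "norm (ext_Gamma \<rho> (lam + (2 * of_nat k + \<nu>))) \<le> Gamma (a + 2 * real k)"
      using norm_ext_Gamma_le[OF assms, of "lam + (2 * of_nat k + \<nu>)"] elim
      by (simp add: a_def add_ac)
    hence "norm (ext_Gamma \<rho> (lam + (2 * of_nat k + \<nu>))) *
          (norm (rGamma lam) * norm (rGamma (\<nu> + of_nat k + 1))
           * norm (rGamma (\<nu> + 2 * of_nat k + 1)) * norm (b * w) ^ k / fact k)
        \<le> Gamma (a + 2 * real k) * (norm (rGamma lam) * norm (rGamma (\<nu> + of_nat k + 1))
           * norm (rGamma (\<nu> + 2 * of_nat k + 1)) * norm (b * w) ^ k / fact k)"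
      by (rule mult_right_mono) auto
    thus ?case
      by (simp add: clifford_coeff_def ext_pochhammer_def norm_mult norm_divide norm_power
          power_mult_distrib mult_ac)
  qed
qed

section \<open>The differential equation of the entire Bessel-Clifford function\<close>

definition clifford_entire ::
    "complex \<Rightarrow> complex \<Rightarrow> complex \<Rightarrow> complex \<Rightarrow> complex \<Rightarrow> complex" where
  "clifford_entire \<nu> b lam \<rho> w = (\<Sum>k. clifford_coeff \<nu> b lam \<rho> k * w ^ k)"

text \<open>
  This is the identity of \<open>clifford_entire_ode\<close> read coefficientwise. The factor \<open>k + \<nu>/2 + 1\<close> is half
  of \<open>2k + \<nu> + 2\<close> and lowers the argument of one \<open>rGamma\<close> by 1, the factor \<open>Suc k\<close> lowers the
  factorial, and \<open>1/\<Gamma>(\<lambda> - 1) = (\<lambda> - 1)/\<Gamma>(\<lambda>)\<close> moves the upper parameter.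
\<close>
lemma clifford_coeff_Suc:
  "(of_nat k + \<nu> / 2 + 1) * of_nat (Suc k) * clifford_coeff \<nu> b (lam - 1) \<rho> (Suc k) =
     - b * (lam - 1) / 2 * clifford_coeff (\<nu> + 1) b lam \<rho> k"
proof -
  have G: "rGamma (\<nu> + 1 + 2 * of_nat k + 1) =
      2 * (of_nat k + \<nu> / 2 + 1) * rGamma (\<nu> + 2 * of_nat (Suc k) + 1)"
    using rGamma_plus1[of "\<nu> + 2 * of_nat k + 2"] by (simp add: algebra_simps)
  have L: "rGamma (lam - 1) = (lam - 1) * rGamma lam"
    using rGamma_plus1[of "lam - 1"] by simp
  have E: "lam - 1 + (2 * of_nat (Suc k) + \<nu>) = lam + (2 * of_nat k + (\<nu> + 1))"
    by simp
  have F: "\<nu> + of_nat (Suc k) + 1 = \<nu> + 1 + of_nat k + 1"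
    by simp
  have fct: "(fact (Suc k) :: complex) = of_nat (Suc k) * fact k"
    by simp
  have cancel: "t * s * ((- b) * P * (E * ((lam - 1) * r)) * g1 * g2 / (s * f)) =
      - b * (lam - 1) / 2 * (P * (E * r) * g1 * (2 * t * g2) / f)"
    if "s \<noteq> 0" "f \<noteq> 0" for t s P E r g1 g2 f :: complex
    using that by (simp add: field_simps)
  have "of_nat (Suc k) \<noteq> (0 :: complex)"
    by (rule of_nat_neq_0)
  thus ?thesis
    unfolding clifford_coeff_def ext_pochhammer_def G L E F fct power_Suc
    by (intro cancel) auto
qed

lemma clifford_entire_ode:
  assumes "Re \<rho> \<ge> 0"
  obtains F' F'' where
    "\<And>w. (clifford_entire \<nu> b (lam - 1) \<rho> has_field_derivative F' w) (at w)"
    "\<And>w. (F' has_field_derivative F'' w) (at w)"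
    "\<And>w. w * F'' w + (\<nu> / 2 + 1) * F' w =
            - b * (lam - 1) / 2 * clifford_entire (\<nu> + 1) b lam \<rho> w"
proof
  define a where "a = clifford_coeff \<nu> b (lam - 1) \<rho>"
  have s0: "summable (\<lambda>k. a k * w ^ k)" for w
    unfolding a_def by (rule summable_clifford_series[OF assms])
  have s1: "summable (\<lambda>k. diffs a k * w ^ k)" for w
    by (rule termdiff_converges_all[OF s0])
  have s2: "summable (\<lambda>k. diffs (diffs a) k * w ^ k)" for w
    by (rule termdiff_converges_all[OF s1])
  let ?F' = "\<lambda>w. \<Sum>k. diffs a k * w ^ k"
  let ?F'' = "\<lambda>w. \<Sum>k. diffs (diffs a) k * w ^ k"
  show "(clifford_entire \<nu> b (lam - 1) \<rho> has_field_derivative ?F' w) (at w)" for w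
    using termdiffs_strong_converges_everywhere[OF s0]
    by (simp add: clifford_entire_def[abs_def] a_def)
  show "(?F' has_field_derivative ?F'' w) (at w)" for w
    by (rule termdiffs_strong_converges_everywhere[OF s1])
  show "w * ?F'' w + (\<nu> / 2 + 1) * ?F' w =
          - b * (lam - 1) / 2 * clifford_entire (\<nu> + 1) b lam \<rho> w" for w
  proof -
    have "(\<lambda>k. w * (of_nat k * diffs a k * w ^ (k - Suc 0)) + (\<nu> / 2 + 1) * (diffs a k * w ^ k))
            sums (w * ?F'' w + (\<nu> / 2 + 1) * ?F' w)"
      by (intro sums_add sums_mult diffs_equiv s2 summable_sums s1)
    moreover have "w * (of_nat k * diffs a k * w ^ (k - Suc 0)) + (\<nu> / 2 + 1) * (diffs a k * w ^ k)
        = - b * (lam - 1) / 2 * (clifford_coeff (\<nu> + 1) b lam \<rho> k * w ^ k)" for k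
    proof -
      have "w * (of_nat k * diffs a k * w ^ (k - Suc 0)) = of_nat k * diffs a k * w ^ k"
        by (cases k) auto
      hence "w * (of_nat k * diffs a k * w ^ (k - Suc 0)) + (\<nu> / 2 + 1) * (diffs a k * w ^ k) =
          ((of_nat k + \<nu> / 2 + 1) * of_nat (Suc k) * a (Suc k)) * w ^ k"
        by (simp add: diffs_def algebra_simps)
      thus ?thesis
        unfolding a_def clifford_coeff_Suc by simp
    qed
    ultimately have "(\<lambda>k. - b * (lam - 1) / 2 * (clifford_coeff (\<nu> + 1) b lam \<rho> k * w ^ k))
            sums (w * ?F'' w + (\<nu> / 2 + 1) * ?F' w)"
      by simp
    moreover have "(\<lambda>k. - b * (lam - 1) / 2 * (clifford_coeff (\<nu> + 1) b lam \<rho> k * w ^ k))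
            sums (- b * (lam - 1) / 2 * clifford_entire (\<nu> + 1) b lam \<rho> w)"
      unfolding clifford_entire_def
      by (intro sums_mult summable_sums summable_clifford_series assms)
    ultimately show ?thesis
      by (rule sums_unique2)
  qed
qed

section \<open>Reduction of the multivalued functions to the entire one\<close>

lemma unified_bessel_conv_clifford_entire:
  assumes "Re \<rho> \<ge> 0" and "z \<noteq> 0"
  shows "unified_bessel \<nu> b lam z \<rho> = (z / 2) powr \<nu> * clifford_entire \<nu> b lam \<rho> ((z / 2)\<^sup>2)"
proof -
  have pw: "(z / 2) powr (2 * of_nat k + \<nu>) = (z / 2) powr \<nu> * ((z / 2)\<^sup>2) ^ k" for k
    using assms(2) powr_complexpow[of "z / 2" "2 * k"]
    by (simp add: powr_add power_mult del: powr_complexpow)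
  have "unified_bessel \<nu> b lam z \<rho> =
      (\<Sum>k. (z / 2) powr \<nu> * (clifford_coeff \<nu> b lam \<rho> k * ((z / 2)\<^sup>2) ^ k))"
    unfolding unified_bessel_def pw clifford_coeff_def
    by (simp add: rGamma_inverse_Gamma divide_simps mult_ac)
  also have "\<dots> = (z / 2) powr \<nu> * clifford_entire \<nu> b lam \<rho> ((z / 2)\<^sup>2)"
    unfolding clifford_entire_def
    by (intro suminf_mult summable_clifford_series assms)
  finally show ?thesis .
qed

text \<open>
  Halving keeps the imaginary part of the logarithm inside the principal strip, so this holds on the
  negative axis as well.
\<close>
lemma csqrt_powr:
  assumes "z \<noteq> 0"
  shows "csqrt z powr s = z powr (s / 2)"
proof -
  have "Ln (exp (Ln z / 2)) = Ln z / 2"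
    using mpi_less_Im_Ln[OF assms] Im_Ln_le_pi[OF assms] by (intro Ln_exp) (auto)
  hence Ln: "Ln (csqrt z) = Ln z / 2"
    by (subst csqrt_exp_Ln[OF assms])
  show ?thesis
    using assms by (simp add: powr_def Ln)
qed

lemma gen_bessel_clifford_conv_clifford_entire:
  assumes "Re \<rho> \<ge> 0" and "z \<noteq> 0"
  shows "gen_bessel_clifford \<nu> b lam z \<rho> = clifford_entire \<nu> b lam \<rho> z"
  using assms
  by (simp add: gen_bessel_clifford_def unified_bessel_conv_clifford_entire csqrt_powr
      powr_minus)

text \<open>
  The powers \<open>z\<^sup>-\<^sup>\<nu>\<close>, \<open>z\<^bsup>-1/2\<^esup>\<close> and \<open>z\<^bsup>\<nu>+1/2\<^esup>\<close> cancel and leave the constant \<open>\<surd>\<pi> 2\<^bsup>-\<nu>-1\<^esup>\<close>. The constant is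
  kept as an exponential because everything is computed with logarithms; off the cut,
  \<open>Ln (1/z) = - Ln z\<close>, which fails on the negative axis.
\<close>
lemma gen_spherical_bessel_conv_clifford_entire:
  assumes "Re \<rho> \<ge> 0" and "z \<notin> \<real>\<^sub>\<le>\<^sub>0"
  shows "z powr (- \<nu>) * gen_spherical_bessel \<nu> b c z \<rho> =
    exp (of_real (ln pi) / 2 - (\<nu> + 1) * of_real (ln 2)) *
      clifford_entire (\<nu> + 1 / 2) b (c - 1 / 2) \<rho> ((z / 2)\<^sup>2)"
proof -
  have [simp]: "z \<noteq> 0"
    using assms(2) by auto
  have "\<bar>Im (Ln z)\<bar> < pi"
    using assms(2) mpi_less_Im_Ln[of z] Im_Ln_less_pi[of z] by (auto simp: abs_if)
  hence Ln1: "Ln (of_real pi / (2 * z)) = of_real (ln pi) - of_real (ln 2) - Ln z"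
    by (intro Ln_unique) (auto simp: exp_diff exp_of_real)
  have Ln2: "Ln (z / 2) = Ln z - of_real (ln 2)"
    using \<open>\<bar>Im (Ln z)\<bar> < pi\<close> by (intro Ln_unique) (auto simp: exp_diff exp_of_real)
  have "z powr (- \<nu>) * (csqrt (of_real pi / (2 * z)) * (z / 2) powr (\<nu> + 1 / 2)) =
      exp (- \<nu> * Ln z + ((of_real (ln pi) - of_real (ln 2) - Ln z) / 2 +
         (\<nu> + 1 / 2) * (Ln z - of_real (ln 2))))"
    unfolding exp_add by (simp add: csqrt_exp_Ln powr_def Ln1 Ln2)
  also have "- \<nu> * Ln z + ((of_real (ln pi) - of_real (ln 2) - Ln z) / 2 +
         (\<nu> + 1 / 2) * (Ln z - of_real (ln 2))) =
      of_real (ln pi) / 2 - (\<nu> + 1) * of_real (ln 2)"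
    by (simp add: field_simps)
  finally show ?thesis
    using assms(1)
    by (simp add: gen_spherical_bessel_def unified_bessel_conv_clifford_entire flip: mult.assoc)
qed

section \<open>The two derivative formulas\<close>

lemma gen_bessel_clifford_derivatives:
  assumes "Re \<rho> \<ge> 0" and z: "z \<notin> \<real>\<^sub>\<le>\<^sub>0"
  shows "(\<lambda>w. gen_bessel_clifford \<nu> b (lam - 1) w \<rho>) field_differentiable (at z)"
    and "((\<lambda>w. csqrt w powr (\<nu> + 2) * deriv (\<lambda>u. gen_bessel_clifford \<nu> b (lam - 1) u \<rho>) w)
            has_field_derivative
            - b * (lam - 1) / 2 * csqrt z powr \<nu> * gen_bessel_clifford (\<nu> + 1) b lam z \<rho>) (at z)"
proof -
  let ?S = "- \<real>\<^sub>\<le>\<^sub>0 :: complex set"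
  have S: "open ?S" "z \<in> ?S"
    using z by auto
  have nz: "w \<noteq> 0" if "w \<in> ?S" for w
    using that by auto
  obtain F' F'' where
    F': "\<And>w. (clifford_entire \<nu> b (lam - 1) \<rho> has_field_derivative F' w) (at w)" and
    F'': "\<And>w. (F' has_field_derivative F'' w) (at w)" and
    ode: "\<And>w. w * F'' w + (\<nu> / 2 + 1) * F' w =
            - b * (lam - 1) / 2 * clifford_entire (\<nu> + 1) b lam \<rho> w"
    by (rule clifford_entire_ode[OF assms(1)]) blast
  have D: "((\<lambda>u. gen_bessel_clifford \<nu> b (lam - 1) u \<rho>) has_field_derivative F' w) (at w)"
    if "w \<in> ?S" for w
    using F'[of w] S(1) that
    by (rule has_field_derivative_transform_within_open)
      (simp add: gen_bessel_clifford_conv_clifford_entire assms nz)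
  show "(\<lambda>w. gen_bessel_clifford \<nu> b (lam - 1) w \<rho>) field_differentiable (at z)"
    using D[OF S(2)] by (auto simp: field_differentiable_def)
  have "((\<lambda>w. w powr (\<nu> / 2 + 1) * F' w) has_field_derivative
      (\<nu> / 2 + 1) * z powr (\<nu> / 2) * F' z + F'' z * z powr (\<nu> / 2 + 1)) (at z)"
    using DERIV_mult[OF has_field_derivative_powr[OF z, of "\<nu> / 2 + 1"] F''] by simp
  also have "(\<nu> / 2 + 1) * z powr (\<nu> / 2) * F' z + F'' z * z powr (\<nu> / 2 + 1) =
      z powr (\<nu> / 2) * (z * F'' z + (\<nu> / 2 + 1) * F' z)"
    using S nz by (simp add: powr_add algebra_simps)
  also have "\<dots> = - b * (lam - 1) / 2 * csqrt z powr \<nu> * gen_bessel_clifford (\<nu> + 1) b lam z \<rho>"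
    unfolding ode using S nz
    by (simp add: gen_bessel_clifford_conv_clifford_entire csqrt_powr assms)
  finally show "((\<lambda>w. csqrt w powr (\<nu> + 2) * deriv (\<lambda>u. gen_bessel_clifford \<nu> b (lam - 1) u \<rho>) w)
            has_field_derivative
            - b * (lam - 1) / 2 * csqrt z powr \<nu> * gen_bessel_clifford (\<nu> + 1) b lam z \<rho>) (at z)"
    using S
    by (rule has_field_derivative_transform_within_open)
      (use nz in \<open>simp add: csqrt_powr DERIV_imp_deriv[OF D] add_divide_distrib\<close>)
qed

lemma gen_spherical_bessel_derivatives:
  assumes "Re \<rho> \<ge> 0" and z: "z \<notin> \<real>\<^sub>\<le>\<^sub>0"
  shows "(\<lambda>w. w powr (- \<nu>) * gen_spherical_bessel \<nu> b (c - 1) w \<rho>) field_differentiable (at z)"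
    and "((\<lambda>w. w powr (\<nu> + 3 / 2) *
              deriv (\<lambda>u. u powr (- \<nu>) * gen_spherical_bessel \<nu> b (c - 1) u \<rho>) w)
            has_field_derivative
            - b * z powr (1 / 2) * (c - 3 / 2) * gen_spherical_bessel (\<nu> + 1) b c z \<rho>) (at z)"
proof -
  let ?S = "- \<real>\<^sub>\<le>\<^sub>0 :: complex set"
  have S: "open ?S" "z \<in> ?S"
    using z by auto
  have nz: "w \<noteq> 0" if "w \<in> ?S" for w
    using that by auto
  define \<mu> where "\<mu> = \<nu> + 1 / 2"
  define \<kappa> where "\<kappa> = exp (of_real (ln pi) / 2 - (\<nu> + 1) * complex_of_real (ln 2))"
  obtain F' F'' where
    F': "\<And>w. (clifford_entire \<mu> b (c - 1 / 2 - 1) \<rho> has_field_derivative F' w) (at w)" and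
    F'': "\<And>w. (F' has_field_derivative F'' w) (at w)" and
    ode: "\<And>w. w * F'' w + (\<mu> / 2 + 1) * F' w =
            - b * (c - 1 / 2 - 1) / 2 * clifford_entire (\<mu> + 1) b (c - 1 / 2) \<rho> w"
    by (rule clifford_entire_ode[OF assms(1)]) blast
  \<comment> \<open>\<open>\<mu>/2 + 1 = (\<nu> + 5/2)/2\<close>, so \<open>z\<^bsup>\<nu>+5/2\<^esup>\<close> is the integrating factor in the variable \<open>z\<^sup>2/4\<close>: the inner
    derivative \<open>z/2\<close> raises the prescribed exponent \<open>\<nu> + 3/2\<close> by one.\<close>
  have sq: "((\<lambda>u. (u / 2)\<^sup>2) has_field_derivative w / 2) (at w)" for w :: complex
    by (auto intro!: derivative_eq_intros)
  have D: "((\<lambda>u. u powr (- \<nu>) * gen_spherical_bessel \<nu> b (c - 1) u \<rho>)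
      has_field_derivative \<kappa> * (F' ((w / 2)\<^sup>2) * (w / 2))) (at w)"
    if "w \<in> ?S" for w
    using DERIV_cmult[OF DERIV_chain2[OF F' sq[of w]], of \<kappa>] S(1) that
    by (rule has_field_derivative_transform_within_open)
      (simp add: gen_spherical_bessel_conv_clifford_entire assms \<mu>_def \<kappa>_def algebra_simps)
  show "(\<lambda>w. w powr (- \<nu>) * gen_spherical_bessel \<nu> b (c - 1) w \<rho>) field_differentiable (at z)"
    using D[OF S(2)] by (auto simp: field_differentiable_def)
  have R: "gen_spherical_bessel (\<nu> + 1) b c z \<rho> =
      z powr (\<nu> + 1) * (\<kappa> / 2 * clifford_entire (\<mu> + 1) b (c - 1 / 2) \<rho> ((z / 2)\<^sup>2))"
  proof -
    have "\<kappa> / 2 = exp (of_real (ln pi) / 2 - (\<nu> + 1 + 1) * complex_of_real (ln 2))"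
    proof -
      have "of_real (ln pi) / 2 - (\<nu> + 1 + 1) * complex_of_real (ln 2) =
          of_real (ln pi) / 2 - (\<nu> + 1) * of_real (ln 2) - of_real (ln 2)"
        by (simp only: ring_distribs mult_1) (simp only: diff_diff_eq)
      moreover have "exp (complex_of_real (ln 2)) = 2"
        by (simp add: exp_of_real)
      ultimately show ?thesis
        unfolding \<kappa>_def by (simp only: exp_diff[of _ "of_real (ln 2)"])
    qed
    moreover have "\<nu> + 1 + 1 / 2 = \<mu> + 1"
      by (simp add: \<mu>_def)
    ultimately have "z powr (- (\<nu> + 1)) * gen_spherical_bessel (\<nu> + 1) b c z \<rho> =
        \<kappa> / 2 * clifford_entire (\<mu> + 1) b (c - 1 / 2) \<rho> ((z / 2)\<^sup>2)"
      using gen_spherical_bessel_conv_clifford_entire[OF assms, of "\<nu> + 1" b c] by metis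
    moreover have "z powr (\<nu> + 1) * z powr (- (\<nu> + 1)) = 1"
      using S nz by (simp flip: powr_add)
    ultimately show ?thesis
      by (metis mult.assoc mult_1)
  qed
  have step: "w powr (\<nu> + 5 / 2) = w powr (\<nu> + 3 / 2) * w" if "w \<in> ?S" for w
  proof -
    have "\<nu> + 5 / 2 = \<nu> + 3 / 2 + 1"
      by simp
    thus ?thesis
      using nz[OF that] by (simp only: powr_add powr_to_1)
  qed
  have "\<nu> + 5 / 2 - 1 = \<nu> + 3 / 2"
    by simp
  hence pw: "((\<lambda>w. w powr (\<nu> + 5 / 2)) has_field_derivative
      (\<nu> + 5 / 2) * z powr (\<nu> + 3 / 2)) (at z)"
    using has_field_derivative_powr[OF z, of "\<nu> + 5 / 2"] by (simp only:)
  have "((\<lambda>w. \<kappa> / 2 * (w powr (\<nu> + 5 / 2) * F' ((w / 2)\<^sup>2))) has_field_derivative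
      \<kappa> / 2 * ((\<nu> + 5 / 2) * z powr (\<nu> + 3 / 2) * F' ((z / 2)\<^sup>2) +
        F'' ((z / 2)\<^sup>2) * (z / 2) * z powr (\<nu> + 5 / 2))) (at z)"
    by (rule DERIV_cmult[OF DERIV_mult[OF pw DERIV_chain2[OF F'' sq]]])
  also have "\<kappa> / 2 * ((\<nu> + 5 / 2) * z powr (\<nu> + 3 / 2) * F' ((z / 2)\<^sup>2) +
        F'' ((z / 2)\<^sup>2) * (z / 2) * z powr (\<nu> + 5 / 2)) =
      \<kappa> * z powr (\<nu> + 3 / 2) *
        ((z / 2)\<^sup>2 * F'' ((z / 2)\<^sup>2) + (\<mu> / 2 + 1) * F' ((z / 2)\<^sup>2))"
    unfolding step[OF S(2)] by (simp add: \<mu>_def field_simps power2_eq_square)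
  also have "\<dots> = - b * z powr (1 / 2) * (c - 3 / 2) * gen_spherical_bessel (\<nu> + 1) b c z \<rho>"
  proof -
    have "z powr (\<nu> + 3 / 2) = z powr (1 / 2) * z powr (\<nu> + 1)"
      by (simp add: add.commute flip: powr_add)
    thus ?thesis
      unfolding ode R by simp
  qed
  finally show "((\<lambda>w. w powr (\<nu> + 3 / 2) *
              deriv (\<lambda>u. u powr (- \<nu>) * gen_spherical_bessel \<nu> b (c - 1) u \<rho>) w)
            has_field_derivative
            - b * z powr (1 / 2) * (c - 3 / 2) * gen_spherical_bessel (\<nu> + 1) b c z \<rho>) (at z)"
    using S
  proof (rule has_field_derivative_transform_within_open)
    fix w assume w: "w \<in> ?S"
    show "\<kappa> / 2 * (w powr (\<nu> + 5 / 2) * F' ((w / 2)\<^sup>2)) = w powr (\<nu> + 3 / 2) *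
        deriv (\<lambda>u. u powr (- \<nu>) * gen_spherical_bessel \<nu> b (c - 1) u \<rho>) w"
      by (simp add: DERIV_imp_deriv[OF D[OF w]] step[OF w])
  qed
qed

theorem theorem6p8:
  fixes b \<rho> z :: complex
  assumes "Re \<rho> > 0" and "z \<notin> \<real>\<^sub>\<le>\<^sub>0"
  shows "(\<forall>\<nu> c. Re \<nu> > - 3 / 2 \<longrightarrow> Re c > 1 / 2 \<longrightarrow>
           (\<lambda>w. w powr (- \<nu>) * gen_spherical_bessel \<nu> b (c - 1) w \<rho>) field_differentiable (at z) \<and>
           ((\<lambda>w. w powr (\<nu> + 3 / 2) *
                   deriv (\<lambda>u. u powr (- \<nu>) * gen_spherical_bessel \<nu> b (c - 1) u \<rho>) w)
              has_field_derivative
              - b * z powr (1 / 2) * (c - 3 / 2) * gen_spherical_bessel (\<nu> + 1) b c z \<rho>) (at z))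
       \<and> (\<forall>\<nu> lam. Re \<nu> > - 1 \<longrightarrow> Re lam > 0 \<longrightarrow>
           (\<lambda>w. gen_bessel_clifford \<nu> b (lam - 1) w \<rho>) field_differentiable (at z) \<and>
           ((\<lambda>w. csqrt w powr (\<nu> + 2) *
                   deriv (\<lambda>u. gen_bessel_clifford \<nu> b (lam - 1) u \<rho>) w)
              has_field_derivative
              - b * (lam - 1) / 2 * csqrt z powr \<nu> * gen_bessel_clifford (\<nu> + 1) b lam z \<rho>) (at z))"
  using assms gen_spherical_bessel_derivatives[of \<rho> z] gen_bessel_clifford_derivatives[of \<rho> z]
  by auto

end
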